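(* Let $\alpha$ be an ordinal. A substitution algebra of dimension $\alpha$ is representable if and only if it is embeddable in a substitution algebra of dimension $\alpha$ in which elements are distinguished.
   Context: For a nonempty set $U$, $F_\alpha(U)$ is the set of all functions $U^\alpha\to U$. For $s\in U^\alpha$, $\kappa<\alpha$, $x\in U$, $s\langle\kappa,x\rangle$ agrees with $s$ except that its $\kappa$-th entry is $x$. On $F_\alpha(U)$ set $(f*_\kappa g)(s)=g(s\langle\kappa,f(s)\rangle)$ and $V_\kappa(s)=s_\kappa$. A function substitution algebra of dimension $\alpha$ ($FSA_\alpha$) is $\langle A,*_\kappa,V_\kappa\rangle_{\kappa<\alpha}$ with $A\subseteq F_\alpha(U)$ closed under every $*_\kappa$ and containing every $V_\kappa$. A substitution algebra of dimension $\alpha$ ($SA_\alpha$) is an algebra $\langle A,*_\kappa,v_\kappa\rangle_{\kappa<\alpha}$ satisfying, for all $\kappa,\lambda<\alpha$: (1) $x*_\kappa v_\kappa=x$; (2) $x*_\kappa v_\lambda=v_\lambda$ for $\kappa\neq\lambda$; (3) $v_\kappa*_\kappa x=x$; (4) if $w*_\lambda x=x$ for all $w$, then $x*_\lambda(v_\lambda*_\kappa z)=x*_\lambda(x*_\kappa z)$; (5) $(x*_\kappa y)*_\kappa z=x*_\kappa(y*_\kappa z)$; (6) if $w*_\lambda x=x$ for all $w$, then $x*_\kappa(y*_\lambda z)=(x*_\kappa y)*_\lambda(x*_\kappa z)$ for $\kappa\neq\lambda$. An $SA_\alpha$ is representable if it is isomorphic to an $FSA_\alpha$. For $x\in A$,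 $\Delta x=\{\kappa<\alpha: a*_\kappa x\neq x\text{ for some }a\in A\}$. Elements are distinguished in an $SA_\alpha$ if for all $\kappa<\alpha$ and all $x\neq y$ in $A$ there is $c\in A$ with $\Delta c=\emptyset$ and $c*_\kappa x\neq c*_\kappa y$. *)

theory Defs
  imports Main "HOL-Library.FuncSet"
begin

text \<open>
  The dimension is an ordinal, given as a well-order \<open>\<alpha> :: 'i rel\<close>; the indices
  \<open>\<kappa> < \<alpha>\<close> are the elements of \<open>Field \<alpha>\<close>, and \<open>\<alpha> = {}\<close> is the ordinal zero.
  An algebra is given by its carrier \<open>A\<close>, operations \<open>sub \<kappa> x y\<close> (for \<open>x *\<^sub>\<kappa> y\<close>)
  and constants \<open>v \<kappa>\<close>. The carrier is not required to be nonempty, which matters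
  only in dimension zero, where there are no operations or constants.
\<close>

locale substitution_algebra =
  fixes \<alpha> :: "'i rel"
    and A :: "'a set"
    and sub :: "'i \<Rightarrow> 'a \<Rightarrow> 'a \<Rightarrow> 'a"
    and v :: "'i \<Rightarrow> 'a"
  assumes sub_closed:
      "\<lbrakk>\<kappa> \<in> Field \<alpha>; x \<in> A; y \<in> A\<rbrakk> \<Longrightarrow> sub \<kappa> x y \<in> A"
    and v_closed:
      "\<kappa> \<in> Field \<alpha> \<Longrightarrow> v \<kappa> \<in> A"
    and sub_v_same:
      "\<lbrakk>\<kappa> \<in> Field \<alpha>; x \<in> A\<rbrakk> \<Longrightarrow> sub \<kappa> x (v \<kappa>) = x"
    and sub_v_other:
      "\<lbrakk>\<kappa> \<in> Field \<alpha>; \<mu> \<in> Field \<alpha>; \<kappa> \<noteq> \<mu>; x \<in> A\<rbrakk> \<Longrightarrow> sub \<kappa> x (v \<mu>) = v \<mu>"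
    and v_sub:
      "\<lbrakk>\<kappa> \<in> Field \<alpha>; x \<in> A\<rbrakk> \<Longrightarrow> sub \<kappa> (v \<kappa>) x = x"
    and sub_v_sub:
      "\<lbrakk>\<kappa> \<in> Field \<alpha>; \<mu> \<in> Field \<alpha>; x \<in> A; z \<in> A; \<forall>w\<in>A. sub \<mu> w x = x\<rbrakk>
        \<Longrightarrow> sub \<mu> x (sub \<kappa> (v \<mu>) z) = sub \<mu> x (sub \<kappa> x z)"
    and sub_assoc:
      "\<lbrakk>\<kappa> \<in> Field \<alpha>; x \<in> A; y \<in> A; z \<in> A\<rbrakk>
        \<Longrightarrow> sub \<kappa> (sub \<kappa> x y) z = sub \<kappa> x (sub \<kappa> y z)"
    and sub_distrib:
      "\<lbrakk>\<kappa> \<in> Field \<alpha>; \<mu> \<in> Field \<alpha>; \<kappa> \<noteq> \<mu>; x \<in> A; y \<in> A; z \<in> A;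
          \<forall>w\<in>A. sub \<mu> w x = x\<rbrakk>
        \<Longrightarrow> sub \<kappa> x (sub \<mu> y z) = sub \<mu> (sub \<kappa> x y) (sub \<kappa> x z)"

definition dim_set :: "'i rel \<Rightarrow> 'a set \<Rightarrow> ('i \<Rightarrow> 'a \<Rightarrow> 'a \<Rightarrow> 'a) \<Rightarrow> 'a \<Rightarrow> 'i set"
  where "dim_set \<alpha> A sub x = {\<kappa> \<in> Field \<alpha>. \<exists>a\<in>A. sub \<kappa> a x \<noteq> x}"

definition elements_distinguished ::
    "'i rel \<Rightarrow> 'a set \<Rightarrow> ('i \<Rightarrow> 'a \<Rightarrow> 'a \<Rightarrow> 'a) \<Rightarrow> bool"
  where "elements_distinguished \<alpha> A sub \<longleftrightarrow>
    (\<forall>\<kappa>\<in>Field \<alpha>. \<forall>x\<in>A. \<forall>y\<in>A. x \<noteq> y \<longrightarrow>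
      (\<exists>c\<in>A. dim_set \<alpha> A sub c = {} \<and> sub \<kappa> c x \<noteq> sub \<kappa> c y))"

text \<open>Sequences in \<open>U\<^sup>\<alpha>\<close> and functions on them are extensional, so that equality in
  HOL is equality of functions on the intended domains.\<close>

definition seqs :: "'i rel \<Rightarrow> 'u set \<Rightarrow> ('i \<Rightarrow> 'u) set"
  where "seqs \<alpha> U = Field \<alpha> \<rightarrow>\<^sub>E U"

definition full_functions :: "'i rel \<Rightarrow> 'u set \<Rightarrow> (('i \<Rightarrow> 'u) \<Rightarrow> 'u) set"
  where "full_functions \<alpha> U = seqs \<alpha> U \<rightarrow>\<^sub>E U"

definition fun_sub ::
    "'i rel \<Rightarrow> 'u set \<Rightarrow> 'i \<Rightarrow> (('i \<Rightarrow> 'u) \<Rightarrow> 'u) \<Rightarrow> (('i \<Rightarrow> 'u) \<Rightarrow> 'u) \<Rightarrow> (('i \<Rightarrow> 'u) \<Rightarrow> 'u)"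
  where "fun_sub \<alpha> U \<kappa> f g = (\<lambda>s\<in>seqs \<alpha> U. g (s(\<kappa> := f s)))"

definition fun_var :: "'i rel \<Rightarrow> 'u set \<Rightarrow> 'i \<Rightarrow> (('i \<Rightarrow> 'u) \<Rightarrow> 'u)"
  where "fun_var \<alpha> U \<kappa> = (\<lambda>s\<in>seqs \<alpha> U. s \<kappa>)"

definition function_substitution_algebra ::
    "'i rel \<Rightarrow> 'u set \<Rightarrow> (('i \<Rightarrow> 'u) \<Rightarrow> 'u) set \<Rightarrow> bool"
  where "function_substitution_algebra \<alpha> U F \<longleftrightarrow>
    U \<noteq> {} \<and> F \<subseteq> full_functions \<alpha> U \<and>
    (\<forall>\<kappa>\<in>Field \<alpha>. \<forall>f\<in>F. \<forall>g\<in>F. fun_sub \<alpha> U \<kappa> f g \<in> F) \<and>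
    (\<forall>\<kappa>\<in>Field \<alpha>. fun_var \<alpha> U \<kappa> \<in> F)"

definition sa_embedding ::
    "'i rel \<Rightarrow> 'a set \<Rightarrow> ('i \<Rightarrow> 'a \<Rightarrow> 'a \<Rightarrow> 'a) \<Rightarrow> ('i \<Rightarrow> 'a) \<Rightarrow>
     'b set \<Rightarrow> ('i \<Rightarrow> 'b \<Rightarrow> 'b \<Rightarrow> 'b) \<Rightarrow> ('i \<Rightarrow> 'b) \<Rightarrow> ('a \<Rightarrow> 'b) \<Rightarrow> bool"
  where "sa_embedding \<alpha> A sub v B sub' v' h \<longleftrightarrow>
    h \<in> A \<rightarrow> B \<and> inj_on h A \<and>
    (\<forall>\<kappa>\<in>Field \<alpha>. \<forall>x\<in>A. \<forall>y\<in>A. h (sub \<kappa> x y) = sub' \<kappa> (h x) (h y)) \<and>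
    (\<forall>\<kappa>\<in>Field \<alpha>. h (v \<kappa>) = v' \<kappa>)"

definition sa_isomorphism ::
    "'i rel \<Rightarrow> 'a set \<Rightarrow> ('i \<Rightarrow> 'a \<Rightarrow> 'a \<Rightarrow> 'a) \<Rightarrow> ('i \<Rightarrow> 'a) \<Rightarrow>
     'b set \<Rightarrow> ('i \<Rightarrow> 'b \<Rightarrow> 'b \<Rightarrow> 'b) \<Rightarrow> ('i \<Rightarrow> 'b) \<Rightarrow> ('a \<Rightarrow> 'b) \<Rightarrow> bool"
  where "sa_isomorphism \<alpha> A sub v B sub' v' h \<longleftrightarrow>
    sa_embedding \<alpha> A sub v B sub' v' h \<and> h ` A = B"

text \<open>HOL cannot quantify existentially over types, so the type over which the base
  set \<open>U\<close> (respectively the carrier of the larger algebra) ranges is an explicit argument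
  of the next two predicates.\<close>

definition representable ::
    "'u itself \<Rightarrow> 'i rel \<Rightarrow> 'a set \<Rightarrow> ('i \<Rightarrow> 'a \<Rightarrow> 'a \<Rightarrow> 'a) \<Rightarrow> ('i \<Rightarrow> 'a) \<Rightarrow> bool"
  where "representable T \<alpha> A sub v \<longleftrightarrow>
    (\<exists>(U :: 'u set) F h. function_substitution_algebra \<alpha> U F \<and>
      sa_isomorphism \<alpha> A sub v F (fun_sub \<alpha> U) (fun_var \<alpha> U) h)"

definition embeddable_in_distinguished ::
    "'b itself \<Rightarrow> 'i rel \<Rightarrow> 'a set \<Rightarrow> ('i \<Rightarrow> 'a \<Rightarrow> 'a \<Rightarrow> 'a) \<Rightarrow> ('i \<Rightarrow> 'a) \<Rightarrow> bool"
  where "embeddable_in_distinguished T \<alpha> A sub v \<longleftrightarrow>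
    (\<exists>(B :: 'b set) sub' v' h. substitution_algebra \<alpha> B sub' v' \<and>
      elements_distinguished \<alpha> B sub' \<and> sa_embedding \<alpha> A sub v B sub' v' h)"

text \<open>
  A type that is too small could make the predicates above fail for mere lack of
  elements. They are therefore used at the types \<open>'u + ('a, 'i) base_universe\<close> and
  \<open>'b + ('a, 'i) alg_universe\<close> with \<open>'u\<close> and \<open>'b\<close> arbitrary: the type variables admit base
  sets and algebras of every size (a set over \<open>'u\<close> can be moved along \<open>Inl\<close>), while the
  second summands guarantee enough room. By downward Loewenheim-Skolem, a distinguished
  extension can be cut down to one of size at most that of \<open>('a + 'i + nat) list\<close>;
  its representation needs no more than a product over \<open>'a \<times> 'a\<close> of reduced products
  over finite sets of indices.
\<close>

type_synonym ('a, 'i) alg_universe = "('a + 'i + nat) list"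

type_synonym ('a, 'i) base_universe = "'a \<times> 'a \<Rightarrow> 'i set \<Rightarrow> ('a, 'i) alg_universe"

end

theory Submission
  imports Defs
begin

text \<open>
  The algebra of all functions \<open>U\<^sup>\<alpha> \<rightarrow> U\<close> is distinguished by its constant functions, so a
  representable algebra embeds in a distinguished one. Conversely, let \<open>B\<close> be distinguished. For
  a finite set \<open>\<Gamma>\<close> of indices and elements \<open>\<sigma> \<kappa>\<close> (\<open>\<kappa> \<in> \<Gamma>\<close>) that do not depend on \<open>\<Gamma>\<close>, the
  operators \<open>x \<mapsto> \<sigma> \<kappa> *\<^sub>\<kappa> x\<close> commute, and their composite turns each \<open>x\<close> into an element that
  does not depend on \<open>\<Gamma>\<close>. For each pair of elements to be separated, take the families \<open>t\<close> with
  \<open>t \<Gamma> \<in> B\<close> not depending on \<open>\<Gamma>\<close>, and identify two families when they agree at all large \<open>\<Gamma>\<close>; let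
  \<open>U\<close> be the product of these quotients over the pairs. Represent \<open>x\<close> by the function whose value
  at \<open>s\<close> is, at \<open>\<Gamma>\<close>, the result of substituting (a representative of) \<open>s \<kappa>\<close> at \<open>\<Gamma>\<close> in \<open>x\<close> for
  each \<open>\<kappa> \<in> \<Gamma>\<close>. Distinguishing constants, chosen separately for each \<open>\<Gamma>\<close>, separate the pair.
  Both implications need an extension of bounded size: close under substitution and under
  Skolem functions for distinguishing constants and for dependence on an index.
\<close>

section \<open>Full function algebras\<close>

lemma seqs_upd: "\<lbrakk>s \<in> seqs \<alpha> U; \<kappa> \<in> Field \<alpha>; u \<in> U\<rbrakk> \<Longrightarrow> s(\<kappa> := u) \<in> seqs \<alpha> U"
  by (auto simp: seqs_def PiE_def extensional_def)

lemma full_functions_mem: "\<lbrakk>f \<in> full_functions \<alpha> U; s \<in> seqs \<alpha> U\<rbrakk> \<Longrightarrow> f s \<in> U"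
  by (auto simp: full_functions_def)

lemma fun_sub_apply [simp]: "s \<in> seqs \<alpha> U \<Longrightarrow> fun_sub \<alpha> U \<kappa> f g s = g (s(\<kappa> := f s))"
  by (simp add: fun_sub_def)

lemma fun_var_apply [simp]: "s \<in> seqs \<alpha> U \<Longrightarrow> fun_var \<alpha> U \<kappa> s = s \<kappa>"
  by (simp add: fun_var_def)

lemma full_functions_eqI:
  assumes "f \<in> full_functions \<alpha> U" "g \<in> full_functions \<alpha> U" "\<And>s. s \<in> seqs \<alpha> U \<Longrightarrow> f s = g s"
  shows "f = g"
  using assms unfolding full_functions_def by (rule PiE_ext)

lemma fun_sub_closed:
  "\<lbrakk>\<kappa> \<in> Field \<alpha>; f \<in> full_functions \<alpha> U; g \<in> full_functions \<alpha> U\<rbrakk>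
    \<Longrightarrow> fun_sub \<alpha> U \<kappa> f g \<in> full_functions \<alpha> U"
  by (subst full_functions_def) (simp add: fun_sub_def seqs_upd full_functions_mem)

lemma fun_var_closed: "\<kappa> \<in> Field \<alpha> \<Longrightarrow> fun_var \<alpha> U \<kappa> \<in> full_functions \<alpha> U"
  by (auto simp: fun_var_def full_functions_def seqs_def)

lemma const_closed: "u \<in> U \<Longrightarrow> (\<lambda>s\<in>seqs \<alpha> U. u) \<in> full_functions \<alpha> U"
  by (auto simp: full_functions_def)

text \<open>The carrier contains every constant function, so testing against constants turns the
  side condition of \<open>sub_v_sub\<close> and \<open>sub_distrib\<close> into a pointwise one:
  the value does not depend on the entry at \<open>\<mu>\<close>.\<close>

lemma fun_sub_fixed_iff:
  assumes "\<mu> \<in> Field \<alpha>" "x \<in> full_functions \<alpha> U"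
  shows "(\<forall>w\<in>full_functions \<alpha> U. fun_sub \<alpha> U \<mu> w x = x) \<longleftrightarrow>
    (\<forall>s\<in>seqs \<alpha> U. \<forall>u\<in>U. x (s(\<mu> := u)) = x s)"
proof
  assume *: "\<forall>w\<in>full_functions \<alpha> U. fun_sub \<alpha> U \<mu> w x = x"
  show "\<forall>s\<in>seqs \<alpha> U. \<forall>u\<in>U. x (s(\<mu> := u)) = x s"
  proof (intro ballI)
    fix s u assume "s \<in> seqs \<alpha> U" "u \<in> U"
    then show "x (s(\<mu> := u)) = x s"
      using fun_cong[OF bspec[OF * const_closed], of u s] by simp
  qed
next
  assume "\<forall>s\<in>seqs \<alpha> U. \<forall>u\<in>U. x (s(\<mu> := u)) = x s"
  then show "\<forall>w\<in>full_functions \<alpha> U. fun_sub \<alpha> U \<mu> w x = x"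
    using assms by (auto intro!: full_functions_eqI fun_sub_closed simp: full_functions_mem)
qed

lemma full_substitution_algebra:
  "substitution_algebra \<alpha> (full_functions \<alpha> U) (fun_sub \<alpha> U) (fun_var \<alpha> U)"
proof
  fix \<kappa> \<mu> x z
  assume *: "\<kappa> \<in> Field \<alpha>" "\<mu> \<in> Field \<alpha>" "x \<in> full_functions \<alpha> U" "z \<in> full_functions \<alpha> U"
    and fixed: "\<forall>w\<in>full_functions \<alpha> U. fun_sub \<alpha> U \<mu> w x = x"
  have "\<forall>s\<in>seqs \<alpha> U. \<forall>u\<in>U. x (s(\<mu> := u)) = x s"
    using iffD1[OF fun_sub_fixed_iff[OF *(2,3)] fixed] .
  then show "fun_sub \<alpha> U \<mu> x (fun_sub \<alpha> U \<kappa> (fun_var \<alpha> U \<mu>) z)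
      = fun_sub \<alpha> U \<mu> x (fun_sub \<alpha> U \<kappa> x z)"
    using * by (intro full_functions_eqI[of _ \<alpha> U])
      (auto simp: seqs_upd full_functions_mem fun_sub_closed fun_var_closed)
next
  fix \<kappa> \<mu> x y z
  assume *: "\<kappa> \<in> Field \<alpha>" "\<mu> \<in> Field \<alpha>" "\<kappa> \<noteq> \<mu>"
      "x \<in> full_functions \<alpha> U" "y \<in> full_functions \<alpha> U" "z \<in> full_functions \<alpha> U"
    and fixed: "\<forall>w\<in>full_functions \<alpha> U. fun_sub \<alpha> U \<mu> w x = x"
  have "\<forall>s\<in>seqs \<alpha> U. \<forall>u\<in>U. x (s(\<mu> := u)) = x s"
    using iffD1[OF fun_sub_fixed_iff[OF *(2,4)] fixed] .
  then show "fun_sub \<alpha> U \<kappa> x (fun_sub \<alpha> U \<mu> y z)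
      = fun_sub \<alpha> U \<mu> (fun_sub \<alpha> U \<kappa> x y) (fun_sub \<alpha> U \<kappa> x z)"
    using * by (intro full_functions_eqI[of _ \<alpha> U])
      (auto simp: seqs_upd full_functions_mem fun_sub_closed fun_upd_twist)
qed (auto intro!: full_functions_eqI[of _ \<alpha> U] fun_sub_closed fun_var_closed
    simp: seqs_upd full_functions_mem)

lemma full_distinguished:
  "elements_distinguished \<alpha> (full_functions \<alpha> U) (fun_sub \<alpha> U)"
  unfolding elements_distinguished_def
proof (intro ballI impI)
  fix \<kappa> f g
  assume \<kappa>: "\<kappa> \<in> Field \<alpha>" and fg: "f \<in> full_functions \<alpha> U" "g \<in> full_functions \<alpha> U" "f \<noteq> g"
  then obtain s where s: "s \<in> seqs \<alpha> U" "f s \<noteq> g s"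
    using full_functions_eqI by metis
  \<comment> \<open>The constant is the entry that \<open>s\<close> already has at
    \<open>\<kappa>\<close>, so substituting it leaves the disagreement at \<open>s\<close>
    intact.\<close>
  let ?c = "\<lambda>t\<in>seqs \<alpha> U. s \<kappa>"
  have "s \<kappa> \<in> U"
    using s \<kappa> by (auto simp: seqs_def)
  then have c: "?c \<in> full_functions \<alpha> U"
    by (rule const_closed)
  have "dim_set \<alpha> (full_functions \<alpha> U) (fun_sub \<alpha> U) ?c = {}"
    using c fun_sub_fixed_iff[OF _ c] by (auto simp: dim_set_def seqs_upd)
  moreover have "fun_sub \<alpha> U \<kappa> ?c f s \<noteq> fun_sub \<alpha> U \<kappa> ?c g s"
    using s by simp
  ultimately show "\<exists>c\<in>full_functions \<alpha> U. dim_set \<alpha> (full_functions \<alpha> U) (fun_sub \<alpha> U) c = {} \<and>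
      fun_sub \<alpha> U \<kappa> c f \<noteq> fun_sub \<alpha> U \<kappa> c g"
    using c by metis
qed

section \<open>Simultaneous substitution at finitely many indices\<close>

context substitution_algebra
begin

text \<open>For an index \<open>\<kappa>\<close> of the algebra this is the condition that
  \<open>\<kappa>\<close> lies outside the dimension set of \<open>x\<close>.\<close>

definition indep :: "'i \<Rightarrow> 'a \<Rightarrow> bool"
  where "indep \<kappa> x \<longleftrightarrow> (\<forall>w\<in>A. sub \<kappa> w x = x)"

definition msub :: "('i \<Rightarrow> 'a) \<Rightarrow> 'i list \<Rightarrow> 'a \<Rightarrow> 'a"
  where "msub \<sigma> ks x = foldr (\<lambda>\<kappa>. sub \<kappa> (\<sigma> \<kappa>)) ks x"

text \<open>These are the conditions under which the single substitutions at indices of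
  \<open>\<Gamma>\<close> commute, so that their iteration in list order acts as a simultaneous
  substitution.\<close>

definition admissible :: "'i set \<Rightarrow> ('i \<Rightarrow> 'a) \<Rightarrow> bool"
  where "admissible \<Gamma> \<sigma> \<longleftrightarrow> \<Gamma> \<subseteq> Field \<alpha> \<and>
    (\<forall>\<kappa>\<in>\<Gamma>. \<sigma> \<kappa> \<in> A \<and> (\<forall>\<mu>\<in>\<Gamma>. indep \<mu> (\<sigma> \<kappa>)))"

lemma msub_Nil [simp]: "msub \<sigma> [] x = x"
  and msub_Cons [simp]: "msub \<sigma> (\<kappa> # ks) x = sub \<kappa> (\<sigma> \<kappa>) (msub \<sigma> ks x)"
  by (simp_all add: msub_def)

lemma msub_cong: "(\<And>\<kappa>. \<kappa> \<in> set ks \<Longrightarrow> \<sigma> \<kappa> = \<tau> \<kappa>) \<Longrightarrow> msub \<sigma> ks x = msub \<tau> ks x"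
  by (induction ks) auto

lemma dim_set_empty_iff: "dim_set \<alpha> A sub x = {} \<longleftrightarrow> (\<forall>\<kappa>\<in>Field \<alpha>. indep \<kappa> x)"
  by (auto simp: dim_set_def indep_def)

lemma sub_commute:
  assumes "\<kappa> \<in> Field \<alpha>" "\<mu> \<in> Field \<alpha>" "\<kappa> \<noteq> \<mu>" "c \<in> A" "d \<in> A" "z \<in> A"
    and "indep \<mu> c" "indep \<kappa> d"
  shows "sub \<kappa> c (sub \<mu> d z) = sub \<mu> d (sub \<kappa> c z)"
  using sub_distrib[of \<kappa> \<mu> c d z] assms by (simp add: indep_def)

text \<open>By associativity a further substitution at \<open>\<kappa>\<close> acts on
  \<open>c\<close> only, and \<open>c\<close> absorbs it.\<close>

lemma indep_sub_same:
  assumes "\<kappa> \<in> Field \<alpha>" "c \<in> A" "x \<in> A" "indep \<kappa> c"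
  shows "indep \<kappa> (sub \<kappa> c x)"
  using assms sub_assoc unfolding indep_def by metis

lemma msub_closed:
  assumes "admissible \<Gamma> \<sigma>" "set ks \<subseteq> \<Gamma>" "x \<in> A"
  shows "msub \<sigma> ks x \<in> A"
  using assms(2) assms(1,3)
  by (induction ks) (auto simp: admissible_def intro!: sub_closed)

text \<open>Since the factors commute by \<open>sub_commute\<close>, the one at
  \<open>\<kappa>\<close> can be moved to the outermost position.\<close>

lemma msub_pull:
  assumes "admissible \<Gamma> \<sigma>" "set ks \<subseteq> \<Gamma>" "x \<in> A" "distinct ks" "\<kappa> \<in> set ks"
  shows "msub \<sigma> ks x = sub \<kappa> (\<sigma> \<kappa>) (msub \<sigma> (remove1 \<kappa> ks) x)"
  using assms(2,4,5)
proof (induction ks)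
  case (Cons \<mu> ks)
  show ?case
  proof (cases "\<mu> = \<kappa>")
    case False
    have "set (remove1 \<kappa> ks) \<subseteq> \<Gamma>"
      using Cons.prems set_remove1_subset by fastforce
    then have "msub \<sigma> (remove1 \<kappa> ks) x \<in> A"
      using msub_closed assms(1,3) by blast
    then have "sub \<mu> (\<sigma> \<mu>) (sub \<kappa> (\<sigma> \<kappa>) (msub \<sigma> (remove1 \<kappa> ks) x))
        = sub \<kappa> (\<sigma> \<kappa>) (sub \<mu> (\<sigma> \<mu>) (msub \<sigma> (remove1 \<kappa> ks) x))"
      using Cons.prems assms(1) False by (intro sub_commute) (auto simp: admissible_def)
    then show ?thesis
      using Cons False by simp
  qed simp
qed simp

text \<open>Each factor passes through the operation at \<open>\<kappa>\<close> by
  \<open>sub_distrib\<close>, which requires the substituted element to be independent of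
  \<open>\<kappa>\<close>. Hence admissibility is assumed for a set that contains
  \<open>\<kappa>\<close> besides the listed indices.\<close>

lemma msub_distrib:
  assumes "admissible \<Gamma> \<sigma>" "set ks \<subseteq> \<Gamma>" "x \<in> A" "y \<in> A" "\<kappa> \<in> \<Gamma>" "\<kappa> \<notin> set ks"
  shows "msub \<sigma> ks (sub \<kappa> x y) = sub \<kappa> (msub \<sigma> ks x) (msub \<sigma> ks y)"
  using assms(2,6)
proof (induction ks)
  case (Cons \<mu> ks)
  then have "msub \<sigma> ks x \<in> A" "msub \<sigma> ks y \<in> A"
    using msub_closed assms by auto
  then have "sub \<mu> (\<sigma> \<mu>) (sub \<kappa> (msub \<sigma> ks x) (msub \<sigma> ks y))
      = sub \<kappa> (sub \<mu> (\<sigma> \<mu>) (msub \<sigma> ks x)) (sub \<mu> (\<sigma> \<mu>) (msub \<sigma> ks y))"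
    using Cons.prems assms(1,5)
    by (intro sub_distrib) (auto simp: admissible_def indep_def)
  then show ?case
    using Cons by simp
qed simp

lemma msub_v_other:
  assumes "admissible \<Gamma> \<sigma>" "set ks \<subseteq> \<Gamma>" "\<kappa> \<in> Field \<alpha>" "\<kappa> \<notin> set ks"
  shows "msub \<sigma> ks (v \<kappa>) = v \<kappa>"
  using assms(2,4) assms(1,3)
  by (induction ks) (auto simp: admissible_def subset_iff intro!: sub_v_other)

lemma msub_v:
  assumes "admissible \<Gamma> \<sigma>" "set ks \<subseteq> \<Gamma>" "distinct ks" "\<kappa> \<in> set ks"
  shows "msub \<sigma> ks (v \<kappa>) = \<sigma> \<kappa>"
proof -
  have \<kappa>: "\<kappa> \<in> Field \<alpha>" "\<sigma> \<kappa> \<in> A"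
    using assms by (auto simp: admissible_def)
  have "msub \<sigma> (remove1 \<kappa> ks) (v \<kappa>) = v \<kappa>"
    using assms \<kappa> by (intro msub_v_other[of \<Gamma>]) auto
  then show ?thesis
    using msub_pull[OF assms(1,2) v_closed[OF \<kappa>(1)] assms(3,4)] \<kappa> sub_v_same by simp
qed

end

section \<open>Simultaneous substitution in distinguished algebras\<close>

locale distinguished_algebra = substitution_algebra \<alpha> A sub v
  for \<alpha> :: "'i rel" and A :: "'a set" and sub v +
  assumes distinguished: "elements_distinguished \<alpha> A sub"
begin

lemma distinguishE:
  assumes "\<kappa> \<in> Field \<alpha>" "x \<in> A" "y \<in> A" "x \<noteq> y"
  obtains c where "c \<in> A" "\<And>\<mu>. \<mu> \<in> Field \<alpha> \<Longrightarrow> indep \<mu> c" "sub \<kappa> c x \<noteq> sub \<kappa> c y"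
  using distinguished assms unfolding elements_distinguished_def dim_set_empty_iff by blast

text \<open>The obstacle is that a test element \<open>w\<close> may depend on \<open>\<mu>\<close>,
  so that substitution of \<open>w\<close> at \<open>\<kappa>\<close> need not commute with that of
  \<open>c\<close> at \<open>\<mu>\<close>. If \<open>w\<close> changed the result, some constant
  \<open>d\<close> substituted at \<open>\<mu>\<close> would still detect the change; but
  \<open>d\<close> also makes \<open>w\<close> independent of \<open>\<mu>\<close>, and then
  commuting refutes it.\<close>

lemma indep_sub:
  assumes "\<kappa> \<in> Field \<alpha>" "\<mu> \<in> Field \<alpha>" "\<kappa> \<noteq> \<mu>" "c \<in> A" "y \<in> A"
    and "indep \<kappa> c" "indep \<mu> c" "indep \<kappa> y"
  shows "indep \<kappa> (sub \<mu> c y)"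
  unfolding indep_def
proof (rule ballI, rule ccontr)
  fix w assume w: "w \<in> A" and ne: "sub \<kappa> w (sub \<mu> c y) \<noteq> sub \<mu> c y"
  let ?z = "sub \<mu> c y"
  have z: "?z \<in> A" "indep \<mu> ?z"
    using assms indep_sub_same by (auto intro: sub_closed)
  have wz: "sub \<kappa> w ?z \<in> A"
    using assms w z by (auto intro: sub_closed)
  obtain d where d: "d \<in> A" "\<And>\<mu>. \<mu> \<in> Field \<alpha> \<Longrightarrow> indep \<mu> d"
      "sub \<mu> d (sub \<kappa> w ?z) \<noteq> sub \<mu> d ?z"
    using distinguishE[OF assms(2) wz z(1) ne] by blast
  let ?u = "sub \<mu> d w"
  have u: "?u \<in> A" "indep \<mu> ?u"
    using assms w d indep_sub_same by (auto intro: sub_closed)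
  \<comment> \<open>Distributing \<open>d\<close> replaces \<open>w\<close> by \<open>?u\<close>,
    while \<open>?z\<close> absorbs \<open>d\<close> because it is independent of
    \<open>\<mu>\<close>.\<close>
  have "sub \<mu> d (sub \<kappa> w ?z) = sub \<kappa> ?u (sub \<mu> d ?z)"
    using sub_distrib[of \<mu> \<kappa> d w ?z] assms d w z by (simp add: indep_def)
  also have "\<dots> = sub \<kappa> ?u ?z"
    using z d by (simp add: indep_def)
  also have "\<dots> = sub \<mu> c (sub \<kappa> ?u y)"
    using sub_commute[of \<kappa> \<mu> ?u c y] assms u by simp
  also have "\<dots> = ?z"
    using assms u by (simp add: indep_def)
  also have "\<dots> = sub \<mu> d ?z"
    using z d by (simp add: indep_def)
  finally show False
    using d by simp
qed

lemma msub_indep: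
  assumes "admissible \<Gamma> \<sigma>" "set ks \<subseteq> \<Gamma>" "x \<in> A" "\<kappa> \<in> set ks"
  shows "indep \<kappa> (msub \<sigma> ks x)"
  using assms(2,4)
proof (induction ks)
  case (Cons \<mu> ks)
  have y: "msub \<sigma> ks x \<in> A"
    using Cons.prems msub_closed assms by auto
  show ?case
  proof (cases "\<kappa> = \<mu>")
    case True
    then show ?thesis
      using Cons.prems assms(1) y by (auto simp: admissible_def intro!: indep_sub_same)
  next
    case False
    then have "indep \<kappa> (msub \<sigma> ks x)"
      using Cons by simp
    then show ?thesis
      using Cons.prems assms(1) y False by (auto simp: admissible_def intro!: indep_sub)
  qed
qed simp

text \<open>This is the algebraic form of evaluating \<open>y\<close> at
  \<open>s(\<kappa> := f s)\<close>. Pull the factor at \<open>\<kappa>\<close> to the front,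
  distribute the others over the product, reassociate, and read the result as a substitution whose
  entry at \<open>\<kappa>\<close> is \<open>msub \<sigma> ks x\<close>; \<open>msub_indep\<close>
  keeps the new assignment admissible.\<close>

lemma msub_sub:
  assumes "admissible (set ks) \<sigma>" "x \<in> A" "y \<in> A" "distinct ks" "\<kappa> \<in> set ks"
  shows "msub \<sigma> ks (sub \<kappa> x y) = msub (\<sigma>(\<kappa> := msub \<sigma> ks x)) ks y"
proof -
  let ?ks = "remove1 \<kappa> ks" and ?\<tau> = "\<sigma>(\<kappa> := msub \<sigma> ks x)"
  have \<kappa>: "\<kappa> \<in> Field \<alpha>" "\<sigma> \<kappa> \<in> A"
    using assms by (auto simp: admissible_def)
  have ks: "set ?ks \<subseteq> set ks" "\<kappa> \<notin> set ?ks"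
    using assms(4) by auto
  have cl: "msub \<sigma> ?ks x \<in> A" "msub \<sigma> ?ks y \<in> A" "msub \<sigma> ks x \<in> A"
    using msub_closed[OF assms(1)] ks assms by auto
  have adm: "admissible (set ks) ?\<tau>"
    using assms(1) cl msub_indep[OF assms(1) subset_refl assms(2)]
    by (auto simp: admissible_def)
  have "msub \<sigma> ks (sub \<kappa> x y) = sub \<kappa> (\<sigma> \<kappa>) (msub \<sigma> ?ks (sub \<kappa> x y))"
    using assms \<kappa> by (intro msub_pull[of "set ks"]) (auto intro: sub_closed)
  also have "\<dots> = sub \<kappa> (\<sigma> \<kappa>) (sub \<kappa> (msub \<sigma> ?ks x) (msub \<sigma> ?ks y))"
    using msub_distrib[OF assms(1) ks(1) assms(2,3,5) ks(2)] by simp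
  also have "\<dots> = sub \<kappa> (sub \<kappa> (\<sigma> \<kappa>) (msub \<sigma> ?ks x)) (msub \<sigma> ?ks y)"
    using sub_assoc \<kappa> cl by simp
  also have "\<dots> = sub \<kappa> (msub \<sigma> ks x) (msub \<sigma> ?ks y)"
    using msub_pull[OF assms(1) subset_refl assms(2,4,5)] by simp
  also have "\<dots> = sub \<kappa> (?\<tau> \<kappa>) (msub ?\<tau> ?ks y)"
  proof -
    have "msub \<sigma> ?ks y = msub ?\<tau> ?ks y"
      by (rule msub_cong) (use ks(2) in auto)
    then show ?thesis
      by simp
  qed
  also have "\<dots> = msub ?\<tau> ks y"
    using msub_pull[OF adm subset_refl assms(3,4,5)] by simp
  finally show ?thesis .
qed

text \<open>The constants are chosen one index at a time: after the indices already treated the two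
  results are distinct elements, and distinguishedness at the next index supplies a constant that
  keeps them distinct.\<close>

lemma msub_separates:
  assumes "set ks \<subseteq> Field \<alpha>" "distinct ks" "x \<in> A" "y \<in> A" "x \<noteq> y"
  shows "\<exists>\<sigma>. (\<forall>\<kappa>\<in>set ks. \<sigma> \<kappa> \<in> A \<and> (\<forall>\<mu>\<in>Field \<alpha>. indep \<mu> (\<sigma> \<kappa>))) \<and>
    msub \<sigma> ks x \<noteq> msub \<sigma> ks y"
  using assms(1,2)
proof (induction ks)
  case (Cons \<kappa> ks)
  then obtain \<sigma> where \<sigma>: "\<forall>\<kappa>\<in>set ks. \<sigma> \<kappa> \<in> A \<and> (\<forall>\<mu>\<in>Field \<alpha>. indep \<mu> (\<sigma> \<kappa>))"
      "msub \<sigma> ks x \<noteq> msub \<sigma> ks y"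
    by auto
  have "admissible (set ks) \<sigma>"
    using \<sigma>(1) Cons.prems by (auto simp: admissible_def)
  then have "msub \<sigma> ks x \<in> A" "msub \<sigma> ks y \<in> A"
    using msub_closed assms by blast+
  then obtain c where c: "c \<in> A" "\<And>\<mu>. \<mu> \<in> Field \<alpha> \<Longrightarrow> indep \<mu> c"
      "sub \<kappa> c (msub \<sigma> ks x) \<noteq> sub \<kappa> c (msub \<sigma> ks y)"
    using distinguishE \<sigma>(2) Cons.prems by (metis list.set_intros(1) subset_iff)
  have "msub (\<sigma>(\<kappa> := c)) ks z = msub \<sigma> ks z" for z
    using Cons.prems by (intro msub_cong) auto
  then have "msub (\<sigma>(\<kappa> := c)) (\<kappa> # ks) z = sub \<kappa> c (msub \<sigma> ks z)" for z
    by simp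
  moreover have "\<forall>\<nu>\<in>set (\<kappa> # ks). (\<sigma>(\<kappa> := c)) \<nu> \<in> A \<and> (\<forall>\<mu>\<in>Field \<alpha>. indep \<mu> ((\<sigma>(\<kappa> := c)) \<nu>))"
    using \<sigma>(1) c by simp
  ultimately show ?case
    using c(3) by metis
qed (use assms in simp)

text \<open>Either a given element is itself constant, or some substitution changes it, and then the
  two distinct elements have a distinguishing constant.\<close>

lemma constant_exists:
  assumes "A \<noteq> {}"
  obtains c where "c \<in> A" "\<And>\<kappa>. \<kappa> \<in> Field \<alpha> \<Longrightarrow> indep \<kappa> c"
proof -
  obtain x where x: "x \<in> A"
    using assms by blast
  show ?thesis
  proof (cases "\<forall>\<kappa>\<in>Field \<alpha>. indep \<kappa> x")
    case True
    then show ?thesis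
      using that x by blast
  next
    case False
    then obtain \<kappa> a where "\<kappa> \<in> Field \<alpha>" "a \<in> A" "sub \<kappa> a x \<noteq> x"
      unfolding indep_def by blast
    then show ?thesis
      using distinguishE[of \<kappa> "sub \<kappa> a x" x] that x sub_closed by metis
  qed
qed

section \<open>Representation of distinguished algebras\<close>

text \<open>The type \<open>'k\<close> indexes the pairs \<open>l k\<close>, \<open>r k\<close> to
  be separated, and each \<open>k\<close> has a coordinate of its own in the base set. The injection
  \<open>q\<close> places the base set in a prescribed type.\<close>

lemma representation:
  fixes q :: "('k \<Rightarrow> 'i set \<Rightarrow> 'a) \<Rightarrow> 'z"
    and l r :: "'k \<Rightarrow> 'a"
  assumes q: "inj q" and ne: "A \<noteq> {}"
  shows "\<exists>(U :: 'z set) \<phi>. U \<noteq> {} \<and> \<phi> \<in> A \<rightarrow> full_functions \<alpha> U \<and>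
    (\<forall>\<kappa>\<in>Field \<alpha>. \<forall>x\<in>A. \<forall>y\<in>A. \<phi> (sub \<kappa> x y) = fun_sub \<alpha> U \<kappa> (\<phi> x) (\<phi> y)) \<and>
    (\<forall>\<kappa>\<in>Field \<alpha>. \<phi> (v \<kappa>) = fun_var \<alpha> U \<kappa>) \<and>
    (\<forall>k. l k \<in> A \<longrightarrow> r k \<in> A \<longrightarrow> l k \<noteq> r k \<longrightarrow> \<phi> (l k) \<noteq> \<phi> (r k))"
proof -
  define I where "I = {\<Gamma>. finite \<Gamma> \<and> \<Gamma> \<subseteq> Field \<alpha>}"
  define N where "N = {t :: 'k \<Rightarrow> 'i set \<Rightarrow> 'a. \<forall>k. \<forall>\<Gamma>\<in>I. t k \<Gamma> \<in> A \<and> (\<forall>\<kappa>\<in>\<Gamma>. indep \<kappa> (t k \<Gamma>))}"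
  \<comment> \<open>The threshold \<open>\<Gamma>\<^sub>0\<close> may vary with \<open>k\<close>, so
    the classes of \<open>E\<close> form the product over \<open>k\<close> of the separate reduced
    products.\<close>
  define E where "E (t :: 'k \<Rightarrow> 'i set \<Rightarrow> 'a) t' \<longleftrightarrow> (\<forall>k. \<exists>\<Gamma>\<^sub>0\<in>I. \<forall>\<Gamma>\<in>I. \<Gamma>\<^sub>0 \<subseteq> \<Gamma> \<longrightarrow> t k \<Gamma> = t' k \<Gamma>)"
    for t t'
  define rep where "rep t = (SOME t'. t' \<in> N \<and> E t t')" for t
  \<comment> \<open>A class is coded by the image of one chosen representative, which keeps the base
    set inside \<open>'z\<close>.\<close>
  define cls where "cls t = q (rep t)" for t
  define U where "U = cls ` N"
  define L where "L \<Gamma> = (SOME ks. set ks = \<Gamma> \<and> distinct ks)" for \<Gamma> :: "'i set"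
  have L: "set (L \<Gamma>) = \<Gamma>" "distinct (L \<Gamma>)" if "\<Gamma> \<in> I" for \<Gamma>
    using someI_ex[OF finite_distinct_list[of \<Gamma>]] that unfolding L_def I_def by auto
  obtain c where c: "c \<in> A" "\<And>\<kappa>. \<kappa> \<in> Field \<alpha> \<Longrightarrow> indep \<kappa> c"
    using constant_exists[OF ne] by blast
  define good where "good k \<Gamma> \<sigma> \<longleftrightarrow>
      (\<forall>\<kappa>\<in>\<Gamma>. \<sigma> \<kappa> \<in> A \<and> (\<forall>\<mu>\<in>Field \<alpha>. indep \<mu> (\<sigma> \<kappa>))) \<and>
      (l k \<in> A \<longrightarrow> r k \<in> A \<longrightarrow> l k \<noteq> r k \<longrightarrow> msub \<sigma> (L \<Gamma>) (l k) \<noteq> msub \<sigma> (L \<Gamma>) (r k))"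
    for k \<Gamma> \<sigma>
  have good_ex: "\<exists>\<sigma>. good k \<Gamma> \<sigma>" if "\<Gamma> \<in> I" for k \<Gamma>
  proof (cases "l k \<in> A \<and> r k \<in> A \<and> l k \<noteq> r k")
    case True
    then show ?thesis
      using msub_separates[of "L \<Gamma>" "l k" "r k"] L[OF that] that unfolding good_def by (auto simp: I_def)
  next
    case False
    then show ?thesis
      unfolding good_def using c by (intro exI[of _ "\<lambda>_. c"]) auto
  qed
  define \<sigma> where "\<sigma> k \<Gamma> = (SOME \<sigma>. good k \<Gamma> \<sigma>)" for k \<Gamma>
  have "good k \<Gamma> (\<sigma> k \<Gamma>)" if "\<Gamma> \<in> I" for k \<Gamma>
    using someI_ex[OF good_ex[OF that]] by (simp add: \<sigma>_def)
  then have \<sigma>: "\<And>k \<Gamma> \<kappa>. \<lbrakk>\<Gamma> \<in> I; \<kappa> \<in> \<Gamma>\<rbrakk> \<Longrightarrow>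
        \<sigma> k \<Gamma> \<kappa> \<in> A \<and> (\<forall>\<mu>\<in>Field \<alpha>. indep \<mu> (\<sigma> k \<Gamma> \<kappa>))"
      "\<And>k \<Gamma>. \<lbrakk>\<Gamma> \<in> I; l k \<in> A; r k \<in> A; l k \<noteq> r k\<rbrakk> \<Longrightarrow>
        msub (\<sigma> k \<Gamma>) (L \<Gamma>) (l k) \<noteq> msub (\<sigma> k \<Gamma>) (L \<Gamma>) (r k)"
    unfolding good_def by blast+
  \<comment> \<open>For each index this collects the separating constants chosen at the various
    \<open>\<Gamma>\<close> into one family; the constant \<open>c\<close> fills the places with
    \<open>\<kappa> \<notin> \<Gamma>\<close>.\<close>
  define \<tau> where "\<tau> \<kappa> k \<Gamma> = (if \<kappa> \<in> \<Gamma> then \<sigma> k \<Gamma> \<kappa> else c)" for \<kappa> k \<Gamma>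
  have \<tau>: "\<tau> \<kappa> \<in> N" for \<kappa>
  proof -
    have "\<tau> \<kappa> k \<Gamma> \<in> A \<and> (\<forall>\<mu>\<in>\<Gamma>. indep \<mu> (\<tau> \<kappa> k \<Gamma>))" if "\<Gamma> \<in> I" for k \<Gamma>
      using \<sigma>(1)[OF that, of \<kappa> k] c that by (auto simp: \<tau>_def I_def)
    then show ?thesis
      by (simp add: N_def)
  qed
  \<comment> \<open>The representative of a class depends on the index at which it is substituted: this is
    what allows the infinitely many families \<open>\<tau> \<kappa>\<close> to be used unchanged.\<close>
  define p where "p \<kappa> u = (if u = cls (\<tau> \<kappa>) then \<tau> \<kappa> else inv q u)" for \<kappa> u
  define val where "val x s k \<Gamma> = msub (\<lambda>\<kappa>. p \<kappa> (s \<kappa>) k \<Gamma>) (L \<Gamma>) x" for x s k \<Gamma>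
  define \<phi> where "\<phi> x = (\<lambda>s\<in>seqs \<alpha> U. cls (val x s))" for x
  have E_refl: "E t t" for t
    unfolding E_def I_def by auto
  have E_sym: "E t t' \<Longrightarrow> E t' t" for t t'
    unfolding E_def by metis
  have E_trans: "E t t''" if t: "E t t'" "E t' t''" for t t' t''
    unfolding E_def
  proof
    fix k
    obtain \<Gamma>\<^sub>1 where 1: "\<Gamma>\<^sub>1 \<in> I" "\<forall>\<Gamma>\<in>I. \<Gamma>\<^sub>1 \<subseteq> \<Gamma> \<longrightarrow> t k \<Gamma> = t' k \<Gamma>"
      using t(1) unfolding E_def by metis
    obtain \<Gamma>\<^sub>2 where 2: "\<Gamma>\<^sub>2 \<in> I" "\<forall>\<Gamma>\<in>I. \<Gamma>\<^sub>2 \<subseteq> \<Gamma> \<longrightarrow> t' k \<Gamma> = t'' k \<Gamma>"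
      using t(2) unfolding E_def by metis
    from 1(1) 2(1) have "\<Gamma>\<^sub>1 \<union> \<Gamma>\<^sub>2 \<in> I"
      unfolding I_def by auto
    with 1(2) 2(2) show "\<exists>\<Gamma>\<^sub>0\<in>I. \<forall>\<Gamma>\<in>I. \<Gamma>\<^sub>0 \<subseteq> \<Gamma> \<longrightarrow> t k \<Gamma> = t'' k \<Gamma>"
      by (intro bexI[of _ "\<Gamma>\<^sub>1 \<union> \<Gamma>\<^sub>2"]) auto
  qed
  have rep: "rep t \<in> N" "E t (rep t)" if "t \<in> N" for t
    using someI[of "\<lambda>t'. t' \<in> N \<and> E t t'" t] that E_refl unfolding rep_def by auto
  have cls_eq: "cls t = cls t'" if "E t t'" for t t'
  proof -
    \<comment> \<open>The choice made in \<open>rep t\<close> depends on \<open>t\<close> only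
      through the predicate \<open>E t\<close>.\<close>
    have "E t = E t'"
      using that E_sym E_trans by blast
    then show ?thesis
      by (simp add: cls_def rep_def)
  qed
  have cls_eqD: "E t t'" if "t \<in> N" "t' \<in> N" "cls t = cls t'" for t t'
    using rep that E_sym E_trans injD[OF q] unfolding cls_def by metis
  have p_cls: "p \<kappa> (cls t) \<in> N" "cls (p \<kappa> (cls t)) = cls t" if "t \<in> N" for \<kappa> t
  proof -
    have "inv q (cls t) = rep t"
      using q by (simp add: cls_def)
    moreover have "cls (rep t) = cls t"
      using cls_eq[OF rep(2)[OF that]] by simp
    ultimately show "p \<kappa> (cls t) \<in> N" "cls (p \<kappa> (cls t)) = cls t"
      using \<tau> rep(1)[OF that] by (simp_all add: p_def)
  qed
  have cls_U: "cls t \<in> U" if "t \<in> N" for t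
    using that by (auto simp: U_def)
  have p_U: "p \<kappa> u \<in> N" "cls (p \<kappa> u) = u" if "u \<in> U" for \<kappa> u
    using that p_cls by (auto simp: U_def)
  have "U \<noteq> {}"
    using cls_U \<tau> by blast
  have adm: "admissible \<Gamma> (\<lambda>\<kappa>. p \<kappa> (s \<kappa>) k \<Gamma>)" if "s \<in> seqs \<alpha> U" "\<Gamma> \<in> I" for s k \<Gamma>
  proof -
    have "p \<kappa> (s \<kappa>) \<in> N" if "\<kappa> \<in> \<Gamma>" for \<kappa>
    proof -
      have "\<kappa> \<in> Field \<alpha>"
        using that \<open>\<Gamma> \<in> I\<close> by (auto simp: I_def)
      then show ?thesis
        using p_U(1) \<open>s \<in> seqs \<alpha> U\<close> by (auto simp: seqs_def)
    qed
    then show ?thesis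
      using that by (auto simp: admissible_def N_def I_def)
  qed
  have val_N: "val x s \<in> N" if "x \<in> A" "s \<in> seqs \<alpha> U" for x s
  proof -
    have "val x s k \<Gamma> \<in> A \<and> (\<forall>\<kappa>\<in>\<Gamma>. indep \<kappa> (val x s k \<Gamma>))" if "\<Gamma> \<in> I" for k \<Gamma>
      using adm[OF \<open>s \<in> _\<close> that] L[OF that] \<open>x \<in> A\<close> msub_closed[of \<Gamma>] msub_indep[of \<Gamma>]
      unfolding val_def by simp
    then show ?thesis
      by (simp add: N_def)
  qed
  have full: "\<phi> x \<in> full_functions \<alpha> U" if "x \<in> A" for x
    using that val_N cls_U by (auto simp: \<phi>_def full_functions_def)
  have \<phi>_sub: "\<phi> (sub \<kappa> x y) = fun_sub \<alpha> U \<kappa> (\<phi> x) (\<phi> y)"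
    if \<kappa>: "\<kappa> \<in> Field \<alpha>" and x: "x \<in> A" and y: "y \<in> A" for \<kappa> x y
  proof -
    have "cls (val (sub \<kappa> x y) s) = cls (val y (s(\<kappa> := cls (val x s))))"
      if s: "s \<in> seqs \<alpha> U" for s
    proof (rule cls_eq, unfold E_def, rule allI)
      fix k
      let ?u = "cls (val x s)"
      \<comment> \<open>Both families belong to the class \<open>?u\<close>, so at \<open>k\<close>
        they agree beyond some \<open>\<Gamma>\<^sub>0\<close>. Adding \<open>\<kappa>\<close> to
        this threshold makes \<open>msub_sub\<close> applicable.\<close>
      have "E (val x s) (p \<kappa> ?u)"
        using cls_eqD val_N[OF x s] p_cls by metis
      then obtain \<Gamma>\<^sub>0 where \<Gamma>\<^sub>0: "\<Gamma>\<^sub>0 \<in> I"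
          "\<forall>\<Gamma>\<in>I. \<Gamma>\<^sub>0 \<subseteq> \<Gamma> \<longrightarrow> val x s k \<Gamma> = p \<kappa> ?u k \<Gamma>"
        unfolding E_def by blast
      have "val (sub \<kappa> x y) s k \<Gamma> = val y (s(\<kappa> := ?u)) k \<Gamma>"
        if \<Gamma>: "\<Gamma> \<in> I" "insert \<kappa> \<Gamma>\<^sub>0 \<subseteq> \<Gamma>" for \<Gamma>
      proof -
        have "val (sub \<kappa> x y) s k \<Gamma> =
            msub ((\<lambda>\<kappa>. p \<kappa> (s \<kappa>) k \<Gamma>)(\<kappa> := val x s k \<Gamma>)) (L \<Gamma>) y"
          using msub_sub[of "L \<Gamma>"] adm[OF s \<Gamma>(1)] L[OF \<Gamma>(1)] x y \<Gamma>(2)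
          unfolding val_def by simp
        also have "(\<lambda>\<kappa>. p \<kappa> (s \<kappa>) k \<Gamma>)(\<kappa> := val x s k \<Gamma>)
            = (\<lambda>\<mu>. p \<mu> ((s(\<kappa> := ?u)) \<mu>) k \<Gamma>)"
          using \<Gamma>\<^sub>0(2) \<Gamma> by auto
        finally show ?thesis
          by (simp add: val_def)
      qed
      moreover have "insert \<kappa> \<Gamma>\<^sub>0 \<in> I"
        using \<Gamma>\<^sub>0(1) \<kappa> by (simp add: I_def)
      ultimately show "\<exists>\<Gamma>\<^sub>0\<in>I. \<forall>\<Gamma>\<in>I. \<Gamma>\<^sub>0 \<subseteq> \<Gamma> \<longrightarrow>
          val (sub \<kappa> x y) s k \<Gamma> = val y (s(\<kappa> := ?u)) k \<Gamma>"
        by blast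
    qed
    then show ?thesis
      using cls_U val_N \<kappa> x by (auto simp: \<phi>_def fun_sub_def seqs_upd intro!: restrict_ext)
  qed
  have \<phi>_v: "\<phi> (v \<kappa>) = fun_var \<alpha> U \<kappa>" if \<kappa>: "\<kappa> \<in> Field \<alpha>" for \<kappa>
  proof -
    have "cls (val (v \<kappa>) s) = s \<kappa>" if s: "s \<in> seqs \<alpha> U" for s
    proof -
      \<comment> \<open>As soon as \<open>\<Gamma>\<close> contains \<open>\<kappa>\<close>, the
        variable is replaced by the chosen representative of \<open>s \<kappa>\<close>.\<close>
      have "val (v \<kappa>) s k \<Gamma> = p \<kappa> (s \<kappa>) k \<Gamma>" if "\<Gamma> \<in> I" "{\<kappa>} \<subseteq> \<Gamma>" for k \<Gamma>
        using msub_v[OF adm[OF s that(1)], of "L \<Gamma>" \<kappa>] L[OF that(1)] that(2)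
        unfolding val_def by simp
      moreover have "{\<kappa>} \<in> I"
        using \<kappa> by (simp add: I_def)
      ultimately have "E (val (v \<kappa>) s) (p \<kappa> (s \<kappa>))"
        unfolding E_def by blast
      moreover have "s \<kappa> \<in> U"
        using s \<kappa> by (auto simp: seqs_def)
      ultimately show ?thesis
        using p_U(2) cls_eq by metis
    qed
    then show ?thesis
      by (auto simp: \<phi>_def fun_var_def intro!: restrict_ext)
  qed
  have "\<phi> (l k) \<noteq> \<phi> (r k)" if k: "l k \<in> A" "r k \<in> A" "l k \<noteq> r k" for k
  proof
    assume eq: "\<phi> (l k) = \<phi> (r k)"
    \<comment> \<open>At this sequence \<open>p\<close> returns the families
      \<open>\<tau> \<kappa>\<close> themselves, so the separating constants are used exactly at
      every \<open>\<Gamma>\<close>. Representatives that agree with them only beyond thresholds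
      varying with \<open>\<kappa>\<close> would not ensure this.\<close>
    define s where "s = (\<lambda>\<kappa>\<in>Field \<alpha>. cls (\<tau> \<kappa>))"
    have s: "s \<in> seqs \<alpha> U"
      using \<tau> cls_U by (auto simp: s_def seqs_def)
    have "cls (val (l k) s) = cls (val (r k) s)"
      using fun_cong[OF eq, of s] s by (simp add: \<phi>_def)
    then have "E (val (l k) s) (val (r k) s)"
      using cls_eqD val_N k s by blast
    then obtain \<Gamma> where \<Gamma>: "\<Gamma> \<in> I" "val (l k) s k \<Gamma> = val (r k) s k \<Gamma>"
      unfolding E_def by blast
    have "val x s k \<Gamma> = msub (\<sigma> k \<Gamma>) (L \<Gamma>) x" for x
      unfolding val_def
    proof (rule msub_cong)
      fix \<kappa> assume "\<kappa> \<in> set (L \<Gamma>)"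
      then have "\<kappa> \<in> \<Gamma>" "\<kappa> \<in> Field \<alpha>"
        using L[OF \<Gamma>(1)] \<Gamma>(1) by (auto simp: I_def)
      then show "p \<kappa> (s \<kappa>) k \<Gamma> = \<sigma> k \<Gamma> \<kappa>"
        by (simp add: s_def p_def \<tau>_def)
    qed
    then show False
      using \<sigma>(2) \<Gamma> k by metis
  qed
  then show ?thesis
    using \<open>U \<noteq> {}\<close> full \<phi>_sub \<phi>_v by (intro exI[of _ U] exI[of _ \<phi>]) blast
qed

end

section \<open>Small distinguished extensions\<close>

text \<open>The number labels an operation, so that substitution and the Skolem functions share one
  binary constructor.\<close>

datatype ('a, 'i) skolem_term = Gen 'a | App nat 'i "('a, 'i) skolem_term" "('a, 'i) skolem_term"

primrec code :: "('a, 'i) skolem_term \<Rightarrow> ('a + 'i + nat) list" where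
  "code (Gen a) = [Inl a]"
| "code (App n i s t) = Inr (Inr n) # Inr (Inl i) # code s @ code t"

text \<open>This is unique readability of prefix notation. The arbitrary suffixes let the induction
  pass through the code of the first subterm to that of the second.\<close>

lemma code_append_eq: "code s @ xs = code t @ ys \<Longrightarrow> s = t \<and> xs = ys"
proof (induction s arbitrary: t xs ys)
  case (Gen a)
  then show ?case
    by (cases t) auto
next
  case (App n i s1 s2)
  from App.prems obtain t1 t2 where t: "t = App n i t1 t2"
      and eq: "code s1 @ (code s2 @ xs) = code t1 @ (code t2 @ ys)"
    by (cases t) auto
  show ?case
    using t App.IH(1)[OF eq] App.IH(2)[of xs t2 ys] by simp
qed

lemma inj_code: "inj code"
  by (rule injI) (metis append_Nil2 code_append_eq)

primrec eval_term :: "('a \<Rightarrow> 'c) \<Rightarrow> (nat \<Rightarrow> 'i \<Rightarrow> 'c \<Rightarrow> 'c \<Rightarrow> 'c) \<Rightarrow> ('a, 'i) skolem_term \<Rightarrow> 'c" where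
  "eval_term h f (Gen a) = h a"
| "eval_term h f (App n i s t) = f n i (eval_term h f s) (eval_term h f t)"

inductive_set skolem_closure :: "'a set \<Rightarrow> 'i set \<Rightarrow> ('a \<Rightarrow> 'c) \<Rightarrow>
    (nat \<Rightarrow> 'i \<Rightarrow> 'c \<Rightarrow> 'c \<Rightarrow> 'c) \<Rightarrow> 'c set"
  for A I h f where
  gen: "a \<in> A \<Longrightarrow> h a \<in> skolem_closure A I h f"
| app: "\<lbrakk>i \<in> I; x \<in> skolem_closure A I h f; y \<in> skolem_closure A I h f\<rbrakk>
    \<Longrightarrow> f n i x y \<in> skolem_closure A I h f"

text \<open>Choosing for each element a term with that value is injective, and terms are coded by
  lists.\<close>

lemma skolem_closure_small:
  fixes h :: "'a \<Rightarrow> 'c" and f :: "nat \<Rightarrow> 'i \<Rightarrow> 'c \<Rightarrow> 'c \<Rightarrow> 'c"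
  shows "\<exists>e :: 'c \<Rightarrow> ('a + 'i + nat) list. inj_on e (skolem_closure A I h f)"
proof -
  have "\<exists>t. eval_term h f t = x" if "x \<in> skolem_closure A I h f" for x
    using that
  proof induction
    case (gen a)
    then show ?case
      by (metis eval_term.simps(1))
  next
    case (app i x y n)
    then show ?case
      by (metis eval_term.simps(2))
  qed
  then obtain T where "\<And>x. x \<in> skolem_closure A I h f \<Longrightarrow> eval_term h f (T x) = x"
    by metis
  then have "inj_on T (skolem_closure A I h f)"
    by (metis inj_onI)
  then have "inj_on (code \<circ> T) (skolem_closure A I h f)"
    using inj_code by (intro comp_inj_on) (auto intro: inj_on_subset)
  then show ?thesis
    by blast
qed

text \<open>Closure under the operations alone would not do: an element could appear independent of
  an index in a subset while depending on it in \<open>B\<close>, where the conditional axioms are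
  available. The closure therefore also contains witnesses of dependence, besides distinguishing
  constants.\<close>

lemma small_distinguished_subalgebra:
  fixes h :: "'a \<Rightarrow> 'c" and \<alpha> :: "'i rel"
  assumes "substitution_algebra \<alpha> B sub v" "elements_distinguished \<alpha> B sub"
    and h: "h \<in> A \<rightarrow> B" and v: "\<And>\<kappa>. \<kappa> \<in> Field \<alpha> \<Longrightarrow> v \<kappa> \<in> h ` A"
  shows "\<exists>S (e :: 'c \<Rightarrow> ('a, 'i) alg_universe). h ` A \<subseteq> S \<and> S \<subseteq> B \<and> inj_on e S \<and>
    substitution_algebra \<alpha> S sub v \<and> elements_distinguished \<alpha> S sub"
proof -
  interpret distinguished_algebra \<alpha> B sub v
    using assms by (simp add: distinguished_algebra_def distinguished_algebra_axioms_def)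
  have "\<exists>c\<in>B. (x \<noteq> y \<longrightarrow> dim_set \<alpha> B sub c = {} \<and> sub \<kappa> c x \<noteq> sub \<kappa> c y)"
    if "\<kappa> \<in> Field \<alpha>" "x \<in> B" "y \<in> B" for \<kappa> x y
    using that assms(2) unfolding elements_distinguished_def by blast
  then obtain d where d: "\<And>\<kappa> x y. \<lbrakk>\<kappa> \<in> Field \<alpha>; x \<in> B; y \<in> B\<rbrakk> \<Longrightarrow> d \<kappa> x y \<in> B"
      "\<And>\<kappa> x y. \<lbrakk>\<kappa> \<in> Field \<alpha>; x \<in> B; y \<in> B; x \<noteq> y\<rbrakk> \<Longrightarrow>
        dim_set \<alpha> B sub (d \<kappa> x y) = {} \<and> sub \<kappa> (d \<kappa> x y) x \<noteq> sub \<kappa> (d \<kappa> x y) y"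
    by metis
  \<comment> \<open>Take an element that changes \<open>x\<close> if there is one, and any element
    of \<open>B\<close> otherwise: a single test then decides independence.\<close>
  have "\<exists>w\<in>B. sub \<kappa> w x = x \<longrightarrow> indep \<kappa> x" if "\<kappa> \<in> Field \<alpha>" "x \<in> B" for \<kappa> x
    using that unfolding indep_def by blast
  then obtain w where w: "\<And>\<kappa> x. \<lbrakk>\<kappa> \<in> Field \<alpha>; x \<in> B\<rbrakk> \<Longrightarrow> w \<kappa> x \<in> B"
      "\<And>\<kappa> x. \<lbrakk>\<kappa> \<in> Field \<alpha>; x \<in> B; sub \<kappa> (w \<kappa> x) x = x\<rbrakk> \<Longrightarrow> indep \<kappa> x"
    by metis
  define f where "f n \<kappa> x y =
    (if n = 0 then sub \<kappa> x y else if n = 1 then d \<kappa> x y else w \<kappa> x)" for n :: nat and \<kappa> x y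
  define S where "S = skolem_closure A (Field \<alpha>) h f"
  have S_gen: "h ` A \<subseteq> S"
    unfolding S_def by (auto intro: skolem_closure.gen)
  have S_app: "f n \<kappa> x y \<in> S" if "\<kappa> \<in> Field \<alpha>" "x \<in> S" "y \<in> S" for n \<kappa> x y
    using that unfolding S_def by (rule skolem_closure.app)
  have S_sub: "sub \<kappa> x y \<in> S" and S_d: "d \<kappa> x y \<in> S" and S_w: "w \<kappa> x \<in> S"
    if "\<kappa> \<in> Field \<alpha>" "x \<in> S" "y \<in> S" for \<kappa> x y
    using S_app[OF that, of 0] S_app[OF that, of 1] S_app[OF that, of 2] by (simp_all add: f_def)
  have "x \<in> B" if "x \<in> skolem_closure A (Field \<alpha>) h f" for x
    using that by induction (use h d(1) w(1) in \<open>auto simp: f_def sub_closed\<close>)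
  then have SB: "S \<subseteq> B"
    unfolding S_def by blast
  have ind: "indep \<kappa> x" if "\<kappa> \<in> Field \<alpha>" "x \<in> S" "\<forall>w\<in>S. sub \<kappa> w x = x" for \<kappa> x
    using w(2) S_w that SB by blast
  have "substitution_algebra \<alpha> S sub v"
  proof
    fix \<kappa> \<mu> x z
    assume "\<kappa> \<in> Field \<alpha>" "\<mu> \<in> Field \<alpha>" "x \<in> S" "z \<in> S" "\<forall>w\<in>S. sub \<mu> w x = x"
    then show "sub \<mu> x (sub \<kappa> (v \<mu>) z) = sub \<mu> x (sub \<kappa> x z)"
      using ind SB unfolding indep_def by (intro sub_v_sub) auto
  next
    fix \<kappa> \<mu> x y z
    assume "\<kappa> \<in> Field \<alpha>" "\<mu> \<in> Field \<alpha>" "\<kappa> \<noteq> \<mu>" "x \<in> S" "y \<in> S" "z \<in> S" "\<forall>w\<in>S. sub \<mu> w x = x"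
    then show "sub \<kappa> x (sub \<mu> y z) = sub \<mu> (sub \<kappa> x y) (sub \<kappa> x z)"
      using ind SB unfolding indep_def by (intro sub_distrib) auto
  qed (use S_sub SB v S_gen in \<open>auto simp: sub_v_same sub_v_other v_sub sub_assoc subset_iff\<close>)
  moreover have "elements_distinguished \<alpha> S sub"
    unfolding elements_distinguished_def
  proof (intro ballI impI)
    fix \<kappa> x y assume \<kappa>: "\<kappa> \<in> Field \<alpha>" and xy: "x \<in> S" "y \<in> S" "x \<noteq> y"
    then have "dim_set \<alpha> B sub (d \<kappa> x y) = {} \<and> sub \<kappa> (d \<kappa> x y) x \<noteq> sub \<kappa> (d \<kappa> x y) y"
      using d(2) SB by blast
    \<comment> \<open>With fewer elements to test, the dimension set can only shrink, so constants
      of \<open>B\<close> that lie in \<open>S\<close> remain constants.\<close>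
    moreover have "dim_set \<alpha> S sub (d \<kappa> x y) \<subseteq> dim_set \<alpha> B sub (d \<kappa> x y)"
      using SB by (auto simp: dim_set_def)
    ultimately show "\<exists>c\<in>S. dim_set \<alpha> S sub c = {} \<and> sub \<kappa> c x \<noteq> sub \<kappa> c y"
      using S_d[OF \<kappa> xy(1,2)] by blast
  qed
  moreover obtain e :: "'c \<Rightarrow> ('a, 'i) alg_universe" where "inj_on e S"
    using skolem_closure_small unfolding S_def by blast
  ultimately show ?thesis
    using S_gen SB by blast
qed

section \<open>Transport along injections and change of the carrier type\<close>

lemma transport_distinguished:
  fixes e :: "'b \<Rightarrow> 'c"
  assumes "substitution_algebra \<alpha> B sub v" "elements_distinguished \<alpha> B sub" and e: "inj_on e B"
  shows "\<exists>sub'. substitution_algebra \<alpha> (e ` B) sub' (e \<circ> v) \<and>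
    elements_distinguished \<alpha> (e ` B) sub' \<and>
    (\<forall>\<kappa>\<in>Field \<alpha>. \<forall>x\<in>B. \<forall>y\<in>B. sub' \<kappa> (e x) (e y) = e (sub \<kappa> x y))"
proof -
  interpret substitution_algebra \<alpha> B sub v
    by fact
  define sub' where "sub' \<kappa> x y = e (sub \<kappa> (inv_into B e x) (inv_into B e y))" for \<kappa> x y
  have sub': "sub' \<kappa> (e x) (e y) = e (sub \<kappa> x y)" if "x \<in> B" "y \<in> B" for \<kappa> x y
    using that e by (simp add: sub'_def)
  have fixed: "(\<forall>w\<in>e ` B. sub' \<kappa> w (e x) = e x) \<longleftrightarrow> (\<forall>w\<in>B. sub \<kappa> w x = x)"
    if "\<kappa> \<in> Field \<alpha>" "x \<in> B" for \<kappa> x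
    using that e by (simp add: sub' inj_on_eq_iff sub_closed)
  have "substitution_algebra \<alpha> (e ` B) sub' (e \<circ> v)"
  proof
    fix \<kappa> \<mu> x z
    assume "\<kappa> \<in> Field \<alpha>" "\<mu> \<in> Field \<alpha>" "x \<in> e ` B" "z \<in> e ` B" "\<forall>w\<in>e ` B. sub' \<mu> w x = x"
    then show "sub' \<mu> x (sub' \<kappa> ((e \<circ> v) \<mu>) z) = sub' \<mu> x (sub' \<kappa> x z)"
      using fixed by (auto simp: sub' sub_closed v_closed sub_v_sub)
  next
    fix \<kappa> \<mu> x y z
    assume "\<kappa> \<in> Field \<alpha>" "\<mu> \<in> Field \<alpha>" "\<kappa> \<noteq> \<mu>" "x \<in> e ` B" "y \<in> e ` B" "z \<in> e ` B"
      "\<forall>w\<in>e ` B. sub' \<mu> w x = x"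
    then show "sub' \<kappa> x (sub' \<mu> y z) = sub' \<mu> (sub' \<kappa> x y) (sub' \<kappa> x z)"
      using fixed by (auto simp: sub' sub_closed intro!: arg_cong[of _ _ e] sub_distrib)
  qed (auto simp: sub' sub_closed v_closed sub_v_same sub_v_other v_sub sub_assoc)
  moreover have "elements_distinguished \<alpha> (e ` B) sub'"
    unfolding elements_distinguished_def
  proof (intro ballI impI)
    fix \<kappa> x' y' assume \<kappa>: "\<kappa> \<in> Field \<alpha>" and "x' \<in> e ` B" "y' \<in> e ` B" "x' \<noteq> y'"
    then obtain x y where xy: "x \<in> B" "y \<in> B" "x \<noteq> y" "x' = e x" "y' = e y"
      by blast
    then obtain c where c: "c \<in> B" "dim_set \<alpha> B sub c = {}" "sub \<kappa> c x \<noteq> sub \<kappa> c y"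
      using assms(2) \<kappa> unfolding elements_distinguished_def by blast
    have "dim_set \<alpha> (e ` B) sub' (e c) = {}"
      using c fixed unfolding dim_set_def by blast
    moreover have "sub' \<kappa> (e c) x' \<noteq> sub' \<kappa> (e c) y'"
      using c xy \<kappa> e by (simp add: sub' inj_on_eq_iff sub_closed)
    ultimately show "\<exists>c\<in>e ` B. dim_set \<alpha> (e ` B) sub' c = {} \<and> sub' \<kappa> c x' \<noteq> sub' \<kappa> c y'"
      using c by blast
  qed
  ultimately show ?thesis
    using sub' by blast
qed

text \<open>Shrink the extension to one whose elements are coded by lists, then transport it along
  \<open>j\<close>; the type of the original extension can be arbitrarily large.\<close>

lemma embeddable_change_type:
  fixes \<alpha> :: "'i rel" and A :: "'a set" and j :: "('a, 'i) alg_universe \<Rightarrow> 'd"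
  assumes A: "substitution_algebra \<alpha> A sub v" and j: "inj j"
    and emb: "embeddable_in_distinguished TYPE('c) \<alpha> A sub v"
  shows "embeddable_in_distinguished TYPE('d) \<alpha> A sub v"
proof -
  interpret substitution_algebra \<alpha> A sub v
    by fact
  obtain B :: "'c set" and subB vB h where B: "substitution_algebra \<alpha> B subB vB"
      "elements_distinguished \<alpha> B subB" and h: "sa_embedding \<alpha> A sub v B subB vB h"
    using emb unfolding embeddable_in_distinguished_def by blast
  have hB: "h \<in> A \<rightarrow> B" and h_v: "\<And>\<kappa>. \<kappa> \<in> Field \<alpha> \<Longrightarrow> vB \<kappa> = h (v \<kappa>)"
    using h by (auto simp: sa_embedding_def)
  obtain S and e :: "'c \<Rightarrow> ('a, 'i) alg_universe" where S: "h ` A \<subseteq> S" "S \<subseteq> B" "inj_on e S"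
      "substitution_algebra \<alpha> S subB vB" "elements_distinguished \<alpha> S subB"
    using small_distinguished_subalgebra[OF B hB] h_v v_closed by (metis imageI)
  have je: "inj_on (j \<circ> e) S"
    using S(3) j by (auto intro: comp_inj_on inj_on_subset)
  obtain sub' where sub': "substitution_algebra \<alpha> ((j \<circ> e) ` S) sub' ((j \<circ> e) \<circ> vB)"
      "elements_distinguished \<alpha> ((j \<circ> e) ` S) sub'"
      "\<forall>\<kappa>\<in>Field \<alpha>. \<forall>x\<in>S. \<forall>y\<in>S. sub' \<kappa> ((j \<circ> e) x) ((j \<circ> e) y) = (j \<circ> e) (subB \<kappa> x y)"
    using transport_distinguished[OF S(4,5) je] by blast
  have "inj_on h A"
    using h by (simp add: sa_embedding_def)
  then have "inj_on ((j \<circ> e) \<circ> h) A"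
    by (rule comp_inj_on) (rule inj_on_subset[OF je S(1)])
  then have "sa_embedding \<alpha> A sub v ((j \<circ> e) ` S) sub' ((j \<circ> e) \<circ> vB) ((j \<circ> e) \<circ> h)"
    using h S(1) sub'(3) by (auto simp: sa_embedding_def image_subset_iff)
  then show ?thesis
    using sub' unfolding embeddable_in_distinguished_def by blast
qed

section \<open>The two implications\<close>

lemma representable_imp_embeddable:
  assumes "representable TYPE('u) \<alpha> A sub v"
  shows "embeddable_in_distinguished TYPE(('i \<Rightarrow> 'u) \<Rightarrow> 'u) (\<alpha> :: 'i rel) A sub v"
proof -
  obtain U :: "'u set" and F h where F: "function_substitution_algebra \<alpha> U F"
      and h: "sa_isomorphism \<alpha> A sub v F (fun_sub \<alpha> U) (fun_var \<alpha> U) h"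
    using assms unfolding representable_def by blast
  have "sa_embedding \<alpha> A sub v (full_functions \<alpha> U) (fun_sub \<alpha> U) (fun_var \<alpha> U) h"
    using F h by (auto simp: function_substitution_algebra_def sa_isomorphism_def sa_embedding_def)
  then show ?thesis
    using full_substitution_algebra full_distinguished
    unfolding embeddable_in_distinguished_def by blast
qed

text \<open>Indexing by \<open>'a \<times> 'a\<close>, with the images under \<open>h\<close> of the
  two components as the pair to be separated, makes the representation of \<open>B\<close> injective
  on the image of \<open>A\<close>. Its restriction to that image represents
  \<open>A\<close>.\<close>

lemma embeddable_imp_representable:
  fixes A :: "'a set" and \<alpha> :: "'i rel" and q :: "('a \<times> 'a \<Rightarrow> 'i set \<Rightarrow> 'c) \<Rightarrow> 'z"
  assumes A: "substitution_algebra \<alpha> A sub v" and q: "inj q"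
    and emb: "embeddable_in_distinguished TYPE('c) \<alpha> A sub v"
  shows "representable TYPE('z) \<alpha> A sub v"
proof (cases "A = {}")
  case True
  \<comment> \<open>An empty carrier has no room for variables, so the dimension is zero and the
    empty set of functions over any nonempty base is a function substitution algebra.\<close>
  then have "Field \<alpha> = {}"
    using substitution_algebra.v_closed[OF A] by blast
  with True show ?thesis
    unfolding representable_def
    by (intro exI[of _ UNIV] exI[of _ "{}"] exI[of _ undefined])
      (simp add: function_substitution_algebra_def sa_isomorphism_def sa_embedding_def)
next
  case False
  obtain B :: "'c set" and subB vB h where B: "substitution_algebra \<alpha> B subB vB"
      "elements_distinguished \<alpha> B subB" and h: "sa_embedding \<alpha> A sub v B subB vB h"
    using emb unfolding embeddable_in_distinguished_def by blast
  interpret A: substitution_algebra \<alpha> A sub v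
    by fact
  interpret B: distinguished_algebra \<alpha> B subB vB
    using B by (simp add: distinguished_algebra_def distinguished_algebra_axioms_def)
  have hB: "\<And>x. x \<in> A \<Longrightarrow> h x \<in> B" and inj: "inj_on h A"
      and h_sub: "\<And>\<kappa> x y. \<lbrakk>\<kappa> \<in> Field \<alpha>; x \<in> A; y \<in> A\<rbrakk> \<Longrightarrow> h (sub \<kappa> x y) = subB \<kappa> (h x) (h y)"
      and h_v: "\<And>\<kappa>. \<kappa> \<in> Field \<alpha> \<Longrightarrow> h (v \<kappa>) = vB \<kappa>"
    using h by (auto simp: sa_embedding_def)
  have "B \<noteq> {}"
    using False hB by blast
  then obtain U :: "'z set" and \<phi> where "U \<noteq> {}" and full: "\<phi> \<in> B \<rightarrow> full_functions \<alpha> U"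
    and \<phi>_sub: "\<And>\<kappa> x y. \<lbrakk>\<kappa> \<in> Field \<alpha>; x \<in> B; y \<in> B\<rbrakk> \<Longrightarrow>
      \<phi> (subB \<kappa> x y) = fun_sub \<alpha> U \<kappa> (\<phi> x) (\<phi> y)"
    and \<phi>_v: "\<And>\<kappa>. \<kappa> \<in> Field \<alpha> \<Longrightarrow> \<phi> (vB \<kappa>) = fun_var \<alpha> U \<kappa>"
    and sep: "\<And>k. \<lbrakk>h (fst k) \<in> B; h (snd k) \<in> B; h (fst k) \<noteq> h (snd k)\<rbrakk> \<Longrightarrow>
      \<phi> (h (fst k)) \<noteq> \<phi> (h (snd k))"
    using B.representation[OF q, of "\<lambda>k. h (fst k)" "\<lambda>k. h (snd k)"] by metis
  let ?g = "\<phi> \<circ> h"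
  have g_sub: "?g (sub \<kappa> x y) = fun_sub \<alpha> U \<kappa> (?g x) (?g y)"
    if "\<kappa> \<in> Field \<alpha>" "x \<in> A" "y \<in> A" for \<kappa> x y
    using that h_sub \<phi>_sub hB by simp
  have g_v: "?g (v \<kappa>) = fun_var \<alpha> U \<kappa>" if "\<kappa> \<in> Field \<alpha>" for \<kappa>
    using that h_v \<phi>_v by simp
  have "function_substitution_algebra \<alpha> U (?g ` A)"
    unfolding function_substitution_algebra_def
  proof (intro conjI ballI)
    show "?g ` A \<subseteq> full_functions \<alpha> U"
      using full hB by auto
  next
    fix \<kappa> f g assume \<kappa>: "\<kappa> \<in> Field \<alpha>" and "f \<in> ?g ` A" "g \<in> ?g ` A"
    then obtain x y where "x \<in> A" "y \<in> A" "f = ?g x" "g = ?g y"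
      by blast
    then show "fun_sub \<alpha> U \<kappa> f g \<in> ?g ` A"
      using g_sub[OF \<kappa>] A.sub_closed[OF \<kappa>] by (metis imageI)
  next
    fix \<kappa> assume "\<kappa> \<in> Field \<alpha>"
    then show "fun_var \<alpha> U \<kappa> \<in> ?g ` A"
      using g_v A.v_closed by (metis imageI)
  qed (use \<open>U \<noteq> {}\<close> in simp)
  moreover have "inj_on ?g A"
  proof (rule inj_onI, rule ccontr)
    fix x y assume "x \<in> A" "y \<in> A" "?g x = ?g y" "x \<noteq> y"
    then show False
      using sep[of "(x, y)"] hB inj by (simp add: inj_on_eq_iff)
  qed
  then have "sa_isomorphism \<alpha> A sub v (?g ` A) (fun_sub \<alpha> U) (fun_var \<alpha> U) ?g"
    using g_sub g_v unfolding sa_isomorphism_def sa_embedding_def by blast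
  ultimately show ?thesis
    unfolding representable_def by blast
qed

theorem theorem4p1:
  fixes \<alpha> :: "'i rel"
    and A :: "'a set"
    and sub :: "'i \<Rightarrow> 'a \<Rightarrow> 'a \<Rightarrow> 'a"
    and v :: "'i \<Rightarrow> 'a"
  assumes "Well_order \<alpha>"
    and "substitution_algebra \<alpha> A sub v"
  shows "representable TYPE('u + ('a, 'i) base_universe) \<alpha> A sub v \<longleftrightarrow>
    embeddable_in_distinguished TYPE('b + ('a, 'i) alg_universe) \<alpha> A sub v"
proof
  assume "representable TYPE('u + ('a, 'i) base_universe) \<alpha> A sub v"
  then show "embeddable_in_distinguished TYPE('b + ('a, 'i) alg_universe) \<alpha> A sub v"
    by (rule embeddable_change_type[OF assms(2) inj_Inr representable_imp_embeddable])
next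
  assume "embeddable_in_distinguished TYPE('b + ('a, 'i) alg_universe) \<alpha> A sub v"
  \<comment> \<open>Discarding the summand \<open>'b\<close> first makes the type of families
    exactly \<open>('a, 'i) base_universe\<close>, which \<open>Inr\<close> embeds in the required
    type.\<close>
  then have "embeddable_in_distinguished TYPE(('a, 'i) alg_universe) \<alpha> A sub v"
    by (rule embeddable_change_type[OF assms(2) inj_on_id])
  then show "representable TYPE('u + ('a, 'i) base_universe) \<alpha> A sub v"
    by (rule embeddable_imp_representable[OF assms(2) inj_Inr])
qed

end
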